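(* Let $m=-1$. For every $\gamma<0$ the boundary value problem $$f'''+ff''+f'^2=0 \text{ on } [0,\infty),\qquad f(0)=-\gamma,\quad f''(0)=-1,\quad f'(\infty)=0$$ admits a unique bounded solution, which satisfies $f'(0)=-\frac{1}{\gamma}$, and an infinite number of unbounded solutions, with $f'(0)>-\frac{1}{\gamma}$.
   Context: Here $f'(\infty):=\lim_{t\to\infty}f'(t)$. The equation is the case $m=-1$ of $f'''+(m+2)ff''-(2m+1)f'^2=0$. A solution is a three times differentiable function $f:[0,\infty)\to\mathbb{R}$ satisfying the differential equation on $[0,\infty)$ together with all three boundary conditions; $f'(0)$ is not prescribed. *)

theory Defs
  imports "HOL-Analysis.Analysis"
begin

text \<open>
  Derivative of a function on the half-line; one-sided at the endpoint 0. It is an arbitrary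
  value where the function is not differentiable, so it is always accompanied by a
  differentiability hypothesis below.
\<close>
definition half_deriv :: "(real \<Rightarrow> real) \<Rightarrow> real \<Rightarrow> real" where
  "half_deriv f t = vector_derivative f (at t within {0..})"

text \<open>
  A function \<open>[0,\<infinity>) \<rightarrow> \<real>\<close> is represented by an extensional function on \<open>{0..}\<close>, so that equality
  of solutions, and hence uniqueness and counting, depends only on their values on \<open>[0,\<infinity>)\<close>.
\<close>
definition bvp_solution :: "real \<Rightarrow> (real \<Rightarrow> real) \<Rightarrow> bool" where
  "bvp_solution \<gamma> f \<longleftrightarrow>
     f \<in> extensional {0..} \<and>
     f differentiable_on {0..} \<and>
     half_deriv f differentiable_on {0..} \<and>
     half_deriv (half_deriv f) differentiable_on {0..} \<and>
     (\<forall>t\<ge>0. half_deriv (half_deriv (half_deriv f)) t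
            + f t * half_deriv (half_deriv f) t + (half_deriv f t)\<^sup>2 = 0) \<and>
     f 0 = - \<gamma> \<and>
     half_deriv (half_deriv f) 0 = -1 \<and>
     (half_deriv f \<longlongrightarrow> 0) at_top"

end

theory Submission
  imports Defs "HOL-Real_Asymp.Real_Asymp"
begin

text \<open>
  The equation reads \<open>(f'' + f f')' = 0\<close>, so two integrations give the Riccati equation
  \<open>f' = c t + d - f\<^sup>2/2\<close> with \<open>c = -1 - \<gamma> f'(0)\<close> and \<open>d = f'(0) + \<gamma>\<^sup>2/2\<close>.
  The condition \<open>f'(\<infinity>) = 0\<close> excludes \<open>c < 0\<close>, forces \<open>f\<close> to be bounded if \<open>c = 0\<close> and unbounded
  if \<open>c > 0\<close>. Conversely, for every \<open>c \<ge> 0\<close> the substitution \<open>f = 2 u'/u\<close> turns the Riccati equation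
  into \<open>u'' = (c t + d) u / 2\<close>, whose power series solution is entire with nonnegative coefficients.
  The condition at infinity follows from l'Hopital's rule applied to \<open>u\<^sup>2 f' / u\<^sup>2\<close>, because
  \<open>(u\<^sup>2 f')' = c u\<^sup>2\<close>.
\<close>

section \<open>Derivatives on the half-line\<close>

text \<open>A connected set with more than one point has no isolated points. Nontriviality of this
  filter is what makes the one-sided derivative unique, also at the endpoint 0.\<close>

lemma at_within_Ici_neq_bot:
  fixes t :: real
  assumes "t \<ge> 0"
  shows "at t within {0..} \<noteq> bot"
proof -
  have "t islimpt {0..}"
  proof (rule connected_imp_perfect)
    show "{0..} \<noteq> {x}" for x :: real
      using infinite_Ici[of "0::real"] by auto
  qed (use assms in auto)
  then show ?thesis by (simp add: trivial_limit_within)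
qed

lemma half_deriv_eqI:
  assumes "(f has_real_derivative D) (at t within {0..})" "t \<ge> 0"
  shows "half_deriv f t = D"
proof -
  have "at t within {0..} \<noteq> bot"
    using assms(2) by (intro at_within_Ici_neq_bot)
  then show ?thesis
    unfolding half_deriv_def
    using assms(1) by (intro vector_derivative_within) (simp_all add: has_real_derivative_iff_has_vector_derivative)
qed

lemma has_real_derivative_half_deriv:
  assumes "f differentiable_on {0..}" "t \<ge> 0"
  shows "(f has_real_derivative half_deriv f t) (at t within {0..})"
proof -
  have "f differentiable (at t within {0..})"
    using assms by (auto simp: differentiable_on_def)
  then obtain D where "(f has_real_derivative D) (at t within {0..})"
    using real_differentiableE by blast
  then show ?thesis
    using half_deriv_eqI assms(2) by metis
qed

lemma differentiable_on_half_derivI: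
  assumes "\<And>t. t \<ge> 0 \<Longrightarrow> (f has_real_derivative g t) (at t within {0..})"
  shows "f differentiable_on {0..}" "\<And>t. t \<ge> 0 \<Longrightarrow> half_deriv f t = g t"
  using assms by (auto simp: differentiable_on_def real_differentiable_def intro!: half_deriv_eqI)

lemma has_real_derivative_cong_half_line:
  fixes f g :: "real \<Rightarrow> real"
  assumes "(g has_real_derivative D) (at t within {0..})" "t \<ge> 0"
    and "\<And>s. s \<ge> 0 \<Longrightarrow> f s = g s"
  shows "(f has_real_derivative D) (at t within {0..})"
  by (rule has_field_derivative_transform_within[OF assms(1) zero_less_one]) (use assms in auto)

section \<open>Consequences of the first integral\<close>

lemma bvp_first_integral:
  assumes sol: "bvp_solution \<gamma> f" and t: "t \<ge> 0"
  shows "half_deriv f t = (-1 - \<gamma> * half_deriv f 0) * t + (half_deriv f 0 + \<gamma>\<^sup>2 / 2) - (f t)\<^sup>2 / 2"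
proof -
  let ?g = "half_deriv f" and ?h = "half_deriv (half_deriv f)"
  let ?k = "half_deriv ?h"
  let ?c = "-1 - \<gamma> * ?g 0"
  have df: "(f has_real_derivative ?g s) (at s within {0..})"
    and dg: "(?g has_real_derivative ?h s) (at s within {0..})"
    and dh: "(?h has_real_derivative ?k s) (at s within {0..})" if "s \<ge> 0" for s
    using sol that by (auto simp: bvp_solution_def intro!: has_real_derivative_half_deriv)
  have ode: "?k s + f s * ?h s + (?g s)\<^sup>2 = 0" if "s \<ge> 0" for s
    using sol that by (auto simp: bvp_solution_def)
  have init: "f 0 = -\<gamma>" "?h 0 = -1"
    using sol by (auto simp: bvp_solution_def)
  have "((\<lambda>s. ?h s + f s * ?g s) has_real_derivative 0) (at s within {0..})" if "s \<in> {0..}" for s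
  proof -
    have "s \<ge> 0" using that by simp
    show ?thesis
      by (rule DERIV_cong[OF DERIV_add[OF dh DERIV_mult[OF df dg]], OF \<open>s \<ge> 0\<close> \<open>s \<ge> 0\<close> \<open>s \<ge> 0\<close>])
        (use ode[OF \<open>s \<ge> 0\<close>, unfolded power2_eq_square] mult.commute[of "?h s" "f s"] in linarith)
  qed
  then have const: "\<exists>c. \<forall>s\<in>{0..}. ?h s + f s * ?g s = c"
    by (rule has_field_derivative_zero_constant[OF convex_real_interval(1)])
  have first: "?h s = ?c - f s * ?g s" if "s \<ge> 0" for s
  proof -
    have "?h s + f s * ?g s = ?h 0 + f 0 * ?g 0"
      using const that by auto
    then show ?thesis using init by simp
  qed
  \<comment> \<open>Second integration: \<open>f s * ?g s\<close> is the derivative of half the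
    square of \<open>f\<close>, so \<open>first\<close> makes this combination constant.\<close>
  have "((\<lambda>s. ?g s + (f s)\<^sup>2 / 2 - ?c * s) has_real_derivative 0) (at s within {0..})"
    if "s \<in> {0..}" for s
  proof -
    have "s \<ge> 0" using that by simp
    show ?thesis
      by (auto intro!: derivative_eq_intros df dg \<open>s \<ge> 0\<close> simp: first[OF \<open>s \<ge> 0\<close>] algebra_simps)
  qed
  then have "\<exists>d. \<forall>s\<in>{0..}. ?g s + (f s)\<^sup>2 / 2 - ?c * s = d"
    by (rule has_field_derivative_zero_constant[OF convex_real_interval(1)])
  then have "?g t + (f t)\<^sup>2 / 2 - ?c * t = ?g 0 + (f 0)\<^sup>2 / 2 - ?c * 0"
    using t by (metis atLeast_iff order_refl)
  then show ?thesis
    using init by simp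
qed

text \<open>Dropping the square in the first integral leaves f' <= c t + d. A negative c would push
  f' below -1 for large t, against f' -> 0.\<close>

lemma bvp_first_integral_nonneg:
  assumes sol: "bvp_solution \<gamma> f"
  shows "-1 - \<gamma> * half_deriv f 0 \<ge> 0"
proof (rule ccontr)
  let ?c = "-1 - \<gamma> * half_deriv f 0" and ?d = "half_deriv f 0 + \<gamma>\<^sup>2 / 2"
  assume "\<not> ?c \<ge> 0"
  then have "?c < 0" by simp
  have "eventually (\<lambda>t. c * t + d \<le> -1) at_top" if "c < 0" for c d :: real
    using that by real_asymp
  from this[OF \<open>?c < 0\<close>] have "eventually (\<lambda>t. ?c * t + ?d \<le> -1) at_top" .
  moreover have "eventually (\<lambda>t. half_deriv f t > -1) at_top"
    using sol by (intro order_tendstoD) (auto simp: bvp_solution_def)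
  ultimately have "eventually (\<lambda>t. ?c * t + ?d \<le> -1 \<and> half_deriv f t > -1 \<and> t \<ge> 0) at_top"
    by (intro eventually_conj eventually_ge_at_top)
  then obtain t where t: "?c * t + ?d \<le> -1" "half_deriv f t > -1" "t \<ge> 0"
    using eventually_happens'[OF trivial_limit_at_top_linorder] by blast
  have "half_deriv f t \<le> ?c * t + ?d"
    unfolding bvp_first_integral[OF sol t(3)] by simp
  with t show False by linarith
qed

text \<open>If |f| <= B, then f' >= c t + d - B^2/2, which is incompatible with f' -> 0 when c > 0.
  If c = 0, then f^2 = 2 (d - f') is at most 2 d + 2 as soon as f' > -1, and continuity handles the
  remaining compact interval.\<close>

lemma bvp_solution_bounded_iff:
  assumes sol: "bvp_solution \<gamma> f"
  shows "bounded (f ` {0..}) \<longleftrightarrow> -1 - \<gamma> * half_deriv f 0 = 0"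
proof -
  let ?c = "-1 - \<gamma> * half_deriv f 0" and ?d = "half_deriv f 0 + \<gamma>\<^sup>2 / 2"
  have lim: "(half_deriv f \<longlongrightarrow> 0) at_top"
    using sol by (auto simp: bvp_solution_def)
  have "?c = 0" if "bounded (f ` {0..})"
  proof -
    from that obtain B where B: "\<And>t. t \<ge> 0 \<Longrightarrow> \<bar>f t\<bar> \<le> B"
      by (auto simp: bounded_iff)
    show ?thesis
    proof (rule ccontr)
      assume "?c \<noteq> 0"
      then have "?c > 0"
        using bvp_first_integral_nonneg[OF sol] by simp
      have "eventually (\<lambda>t. d + c * t \<ge> 1) at_top" if "c > 0" for c d :: real
        using that by real_asymp
      from this[OF \<open>?c > 0\<close>] have "eventually (\<lambda>t. ?d - B\<^sup>2 / 2 + ?c * t \<ge> 1) at_top" .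
      moreover have "eventually (\<lambda>t. half_deriv f t < 1) at_top"
        using lim by (intro order_tendstoD) auto
      ultimately have "eventually (\<lambda>t. ?d - B\<^sup>2 / 2 + ?c * t \<ge> 1 \<and> half_deriv f t < 1 \<and> t \<ge> 0) at_top"
        by (intro eventually_conj eventually_ge_at_top)
      then obtain t where t: "?d - B\<^sup>2 / 2 + ?c * t \<ge> 1" "half_deriv f t < 1" "t \<ge> 0"
        using eventually_happens'[OF trivial_limit_at_top_linorder] by blast
      have "(f t)\<^sup>2 \<le> B\<^sup>2"
        using B[OF t(3)] by (simp add: abs_le_square_iff[symmetric])
      with t(1,2) bvp_first_integral[OF sol t(3)] show False by linarith
    qed
  qed
  moreover have "bounded (f ` {0..})" if c: "?c = 0"
  proof -
    have "eventually (\<lambda>t. half_deriv f t > -1) at_top"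
      using lim by (intro order_tendstoD) auto
    then obtain T where T: "\<And>t. t \<ge> T \<Longrightarrow> half_deriv f t > -1"
      by (auto simp: eventually_at_top_linorder)
    have sq: "(f t)\<^sup>2 \<le> 2 * ?d + 2" if "t \<ge> T" "t \<ge> 0" for t
      using T[OF that(1)] bvp_first_integral[OF sol that(2)] unfolding c by simp
    have "bounded (f ` {max T 0..})"
    proof (rule boundedI)
      show "norm x \<le> sqrt (2 * ?d + 2)" if "x \<in> f ` {max T 0..}" for x
        using that sq by (auto intro!: real_le_rsqrt)
    qed
    moreover have "bounded (f ` {0..max T 0})"
    proof (intro compact_imp_bounded compact_continuous_image)
      have "continuous_on {0..} f"
        using sol by (auto simp: bvp_solution_def intro: differentiable_imp_continuous_on)
      then show "continuous_on {0..max T 0} f"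
        by (rule continuous_on_subset) auto
    qed auto
    ultimately have "bounded (f ` {0..max T 0} \<union> f ` {max T 0..})" by simp
    then show ?thesis
      by (rule bounded_subset) force
  qed
  ultimately show ?thesis by blast
qed

text \<open>Boundedness means c = 0, which determines the initial slope since
  \<open>\<gamma> \<noteq> 0\<close>. Both functions then solve the same Riccati equation with the
  same initial value, and a Gronwall argument for their difference applies.\<close>

lemma bounded_bvp_solution_unique:
  assumes f: "bvp_solution \<gamma> f" "bounded (f ` {0..})"
    and g: "bvp_solution \<gamma> g" "bounded (g ` {0..})"
    and \<gamma>: "\<gamma> \<noteq> 0"
  shows "f = g"
proof -
  obtain A where A: "\<And>t. t \<ge> 0 \<Longrightarrow> \<bar>f t\<bar> \<le> A"
    using f(2) by (auto simp: bounded_iff)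
  obtain B where B: "\<And>t. t \<ge> 0 \<Longrightarrow> \<bar>g t\<bar> \<le> B"
    using g(2) by (auto simp: bounded_iff)
  let ?K = "A + B"
  have c: "-1 - \<gamma> * half_deriv f 0 = 0" "-1 - \<gamma> * half_deriv g 0 = 0"
    using f g bvp_solution_bounded_iff by auto
  have "\<gamma> * (half_deriv f 0 - half_deriv g 0) = 0"
    using c by (simp add: algebra_simps)
  then have a: "half_deriv f 0 = half_deriv g 0"
    using \<gamma> by simp
  have df: "(f has_real_derivative half_deriv f s) (at s within {0..})"
    and dg: "(g has_real_derivative half_deriv g s) (at s within {0..})" if "s \<ge> 0" for s
    using f g that by (auto simp: bvp_solution_def intro!: has_real_derivative_half_deriv)
  have diff: "half_deriv f s - half_deriv g s = - ((f s + g s) / 2) * (f s - g s)" if "s \<ge> 0" for s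
    unfolding bvp_first_integral[OF f(1) that] bvp_first_integral[OF g(1) that] a
    by (simp add: power2_eq_square field_simps)
  \<comment> \<open>The square w of \<open>f - g\<close> satisfies w' = -(f + g) w <= K w with K = A
    + B, so the exponential weight makes \<open>h\<close> nonincreasing. It starts at 0.\<close>
  define h where "h = (\<lambda>s. (f s - g s)\<^sup>2 * exp (- ?K * s))"
  have dh: "(h has_real_derivative
      ((- (f s + g s) - ?K) * ((f s - g s)\<^sup>2 * exp (- ?K * s)))) (at s within {0..})"
    if "s \<ge> 0" for s
    unfolding h_def
    using diff[OF that]
    by (auto intro!: derivative_eq_intros df dg that simp: power2_eq_square) (simp add: algebra_simps)
  have "f t = g t" if "t \<ge> 0" for t
  proof -
    have "h t \<le> h 0"
    proof (rule DERIV_nonpos_imp_decreasing_open[OF that])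
      show "\<exists>y. (h has_real_derivative y) (at s) \<and> y \<le> 0" if "0 < s" "s < t" for s
      proof -
        have "at s within {0..} = at s"
          using that by (intro at_within_interior) simp
        moreover have "- (f s + g s) - ?K \<le> 0"
          using A[of s] B[of s] that by linarith
        ultimately show ?thesis
          using dh[of s] that by (metis less_imp_le mult_nonpos_nonneg mult_nonneg_nonneg zero_le_power2 exp_ge_zero)
      qed
      have "continuous_on {0..} h"
        unfolding continuous_on_eq_continuous_within
        using dh by (metis DERIV_continuous atLeast_iff)
      then show "continuous_on {0..t} h"
        by (rule continuous_on_subset) auto
    qed
    then have "(f t - g t)\<^sup>2 * exp (- ?K * t) \<le> 0"
      using f(1) g(1) by (simp add: h_def bvp_solution_def)
    then show ?thesis
      by (simp add: mult_le_0_iff)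
  qed
  moreover have "f \<in> extensional {0..}" "g \<in> extensional {0..}"
    using f g by (auto simp: bvp_solution_def)
  ultimately show ?thesis
    by (intro extensionalityI) auto
qed

section \<open>The linearised equation\<close>

text \<open>The Taylor coefficients of the solution of \<open>u'' = (c t + d) u / 2\<close>, \<open>u 0 = 1\<close>, \<open>u' 0 = b / 2\<close>.\<close>
fun riccati_coeff :: "real \<Rightarrow> real \<Rightarrow> real \<Rightarrow> nat \<Rightarrow> real" where
  "riccati_coeff b c d 0 = 1"
| "riccati_coeff b c d (Suc 0) = b / 2"
| "riccati_coeff b c d (Suc (Suc 0)) = d / 4"
| "riccati_coeff b c d (Suc (Suc (Suc n))) =
     (d * riccati_coeff b c d (Suc n) + c * riccati_coeff b c d n) / (2 * (real n + 2) * (real n + 3))"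

lemma riccati_coeff_nonneg:
  assumes "b \<ge> 0" "c \<ge> 0" "d \<ge> 0"
  shows "riccati_coeff b c d n \<ge> 0"
  using assms by (induction b c d n rule: riccati_coeff.induct) auto

text \<open>In the recurrence for the terms a_n r^n, the two earlier terms enter with total weight q
  / D, where D grows quadratically in the index. Once D >= q, no term exceeds the maximum of its
  predecessors, so finitely many terms bound all of them.\<close>

lemma riccati_coeff_bounded:
  assumes pos: "b \<ge> 0" "c \<ge> 0" "d \<ge> 0" and r: "r > 0"
  obtains M where "\<And>n. riccati_coeff b c d n * r ^ n \<le> M"
proof -
  let ?a = "riccati_coeff b c d"
  define q where "q = d * r\<^sup>2 + c * r ^ 3"
  obtain N :: nat where N: "real N \<ge> q" using real_arch_simple by blast
  \<comment> \<open>The range ends at \<open>N + 2\<close> because the recurrence reaches back three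
    places: every later n has \<open>n - 3 \<ge> N\<close>.\<close>
  define M where "M = Max ((\<lambda>n. ?a n * r ^ n) ` {..N + 2})"
  have M: "?a n * r ^ n \<le> M" if "n \<le> N + 2" for n
    unfolding M_def using that by (intro Max_ge) auto
  have M0: "M \<ge> 0" using M[of 0] by simp
  have "?a n * r ^ n \<le> M" for n
  proof (induction n rule: less_induct)
    case (less n)
    show ?case
    proof (cases "n \<le> N + 2")
      case True then show ?thesis by (rule M)
    next
      case False
      then have k: "n = Suc (Suc (Suc (n - 3)))" "n - 3 \<ge> N" by auto
      define k where "k = n - 3"
      note k = k[folded k_def]
      let ?D = "2 * (real k + 2) * (real k + 3)"
      have D: "?D > 0" by (intro mult_pos_pos) auto
      have "?D \<ge> q"
      proof -
        have "q \<le> real k" using N k(2) by linarith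
        also have "\<dots> \<le> ?D" by (simp add: algebra_simps)
        finally show ?thesis .
      qed
      have "?a n * r ^ n = (d * r\<^sup>2 * (?a (Suc k) * r ^ Suc k) + c * r ^ 3 * (?a k * r ^ k)) / ?D"
        unfolding k(1) by (simp add: power2_eq_square power3_eq_cube algebra_simps add_divide_distrib)
      also have "\<dots> \<le> (d * r\<^sup>2 * M + c * r ^ 3 * M) / ?D"
        using D pos r less.IH[of k] less.IH[of "Suc k"] k(1)
        by (intro divide_right_mono add_mono mult_left_mono) auto
      also have "\<dots> = q * M / ?D"
        by (simp add: q_def algebra_simps)
      also have "\<dots> \<le> ?D * M / ?D"
        using D M0 \<open>?D \<ge> q\<close> by (intro divide_right_mono mult_right_mono) auto
      also have "\<dots> = M" using D by simp
      finally show ?thesis .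
    qed
  qed
  then show ?thesis using that by blast
qed

text \<open>Boundedness at the larger radius |x| + 1 gives absolute convergence at x by Abel's
  lemma.\<close>

lemma riccati_coeff_summable:
  fixes x :: real
  assumes pos: "b \<ge> 0" "c \<ge> 0" "d \<ge> 0"
  shows "summable (\<lambda>n. riccati_coeff b c d n * x ^ n)"
proof -
  obtain M where M: "\<And>n. riccati_coeff b c d n * (\<bar>x\<bar> + 1) ^ n \<le> M"
  proof -
    have "\<bar>x\<bar> + 1 > 0" by simp
    from riccati_coeff_bounded[OF pos this] show ?thesis using that by blast
  qed
  have "summable (\<lambda>n. norm (riccati_coeff b c d n) * \<bar>x\<bar> ^ n)"
    by (rule Abel_lemma[of _ "\<bar>x\<bar> + 1" _ M])
      (use M riccati_coeff_nonneg[OF pos] in auto)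
  then show ?thesis
    by (intro summable_norm_cancel[of "\<lambda>n. riccati_coeff b c d n * x ^ n"])
      (simp add: abs_mult power_abs)
qed

lemma linear_second_order_solution:
  fixes b c d :: real
  assumes pos: "b \<ge> 0" "c \<ge> 0" "d \<ge> 0"
  obtains u v :: "real \<Rightarrow> real" where
    "u 0 = 1" "v 0 = b / 2"
    "\<And>t. (u has_real_derivative v t) (at t)"
    "\<And>t. (v has_real_derivative (c * t + d) / 2 * u t) (at t)"
    "\<And>t. t \<ge> 0 \<Longrightarrow> u t \<ge> 1 + b / 2 * t"
    "\<And>t. t \<ge> 0 \<Longrightarrow> v t \<ge> b / 2"
proof -
  let ?a = "riccati_coeff b c d"
  define u where "u = (\<lambda>x. \<Sum>n. ?a n * x ^ n)"
  define v where "v = (\<lambda>x. \<Sum>n. diffs ?a n * x ^ n)"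
  have sa: "summable (\<lambda>n. ?a n * x ^ n)" for x
    using riccati_coeff_summable[OF pos] .
  have sd: "summable (\<lambda>n. diffs ?a n * x ^ n)" for x
    by (rule termdiff_converges_all) (rule sa)
  have nonneg: "?a n \<ge> 0" for n using riccati_coeff_nonneg[OF pos] .
  have du: "(u has_real_derivative v t) (at t)" for t
    unfolding u_def v_def by (rule termdiffs_strong_converges_everywhere) (rule sa)
  have dv: "(v has_real_derivative (\<Sum>n. diffs (diffs ?a) n * t ^ n)) (at t)" for t
    unfolding v_def by (rule termdiffs_strong_converges_everywhere) (rule sd)
  \<comment> \<open>The index is shifted by one because the factor t lowers the coefficient index,
    which would become negative in the constant term. That term, d / 2, is added back
    separately.\<close>
  have dd: "diffs (diffs ?a) (Suc n) * t ^ Suc n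
      = d / 2 * (?a (Suc n) * t ^ Suc n) + c * t / 2 * (?a n * t ^ n)" for n t
    by (simp add: diffs_def divide_simps) (simp add: algebra_simps)
  have "(\<Sum>n. diffs (diffs ?a) n * t ^ n) = (c * t + d) / 2 * u t" for t
  proof -
    have "(\<lambda>n. ?a n * t ^ n) sums u t"
      unfolding u_def using sa by (rule summable_sums)
    moreover from this have "(\<lambda>n. ?a (Suc n) * t ^ Suc n) sums (u t - 1)"
      by (subst sums_Suc_iff) simp
    ultimately have "(\<lambda>n. diffs (diffs ?a) (Suc n) * t ^ Suc n) sums
        (d / 2 * (u t - 1) + c * t / 2 * u t)"
      unfolding dd by (intro sums_add sums_mult)
    then have "(\<lambda>n. diffs (diffs ?a) n * t ^ n) sums
        (d / 2 * (u t - 1) + c * t / 2 * u t + diffs (diffs ?a) 0)"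
      by (subst (asm) sums_Suc_iff) simp
    moreover have "diffs (diffs ?a) 0 = d / 2"
      by (simp add: diffs_def)
    ultimately show ?thesis
      by (simp add: sums_unique[symmetric] algebra_simps add_divide_distrib diff_divide_distrib)
  qed
  with dv have dv': "(v has_real_derivative (c * t + d) / 2 * u t) (at t)" for t
    by simp
  have "u t \<ge> 1 + b / 2 * t" if "t \<ge> 0" for t
  proof -
    \<comment> \<open>All terms are nonnegative for t >= 0, so a partial sum is a lower
      bound.\<close>
    have "(\<Sum>n<2. ?a n * t ^ n) \<le> u t"
      unfolding u_def by (rule sum_le_suminf[OF sa]) (use nonneg that in auto)
    then show ?thesis by (simp add: numeral_2_eq_2)
  qed
  moreover have "v t \<ge> b / 2" if "t \<ge> 0" for t
  proof -
    have "(\<Sum>n<1. diffs ?a n * t ^ n) \<le> v t"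
      unfolding v_def
      by (rule sum_le_suminf[OF sd]) (use nonneg that in \<open>auto simp: diffs_def\<close>)
    then show ?thesis by (simp add: diffs_def)
  qed
  moreover have "u 0 = 1" "v 0 = b / 2"
    by (simp_all add: u_def v_def diffs_def)
  ultimately show ?thesis
    using du dv' that by blast
qed

section \<open>Existence for every admissible initial slope\<close>

lemma bvp_solution_exists:
  fixes b a :: real
  assumes b: "b > 0" and a: "b * a \<ge> 1"
  shows "\<exists>f. bvp_solution (- b) f \<and> half_deriv f 0 = a"
proof -
  \<comment> \<open>These are the constants of the first integral for \<open>\<gamma> = - b\<close>
    and f'(0) = a. The hypothesis on \<open>b * a\<close> says exactly that c >= 0.\<close>
  define c where "c = b * a - 1"
  define d where "d = a + b\<^sup>2 / 2"
  have "a > 0" using a b by (smt (verit) mult_nonneg_nonpos)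
  then have pos: "b \<ge> 0" "c \<ge> 0" "d \<ge> 0"
    using a b by (auto simp: c_def d_def)
  obtain u v where uv0: "u 0 = 1" "v 0 = b / 2"
    and du: "\<And>t. (u has_real_derivative v t) (at t)"
    and dv: "\<And>t. (v has_real_derivative (c * t + d) / 2 * u t) (at t)"
    and u_ge: "\<And>t. t \<ge> 0 \<Longrightarrow> u t \<ge> 1 + b / 2 * t"
    and v_ge: "\<And>t. t \<ge> 0 \<Longrightarrow> v t \<ge> b / 2"
    using linear_second_order_solution[OF pos] by metis
  have u_pos: "u t > 0" if "t \<ge> 0" for t
    using u_ge[OF that] b that by (smt (verit) mult_nonneg_nonneg half_gt_zero)
  have v_pos: "v t > 0" if "t \<ge> 0" for t
    using v_ge[OF that] b by simp
  define F where "F = (\<lambda>t. 2 * v t / u t)"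
  \<comment> \<open>\<open>G\<close> and \<open>H\<close> are the values that the Riccati equation
    and its derivative prescribe for F' and F''.\<close>
  define G where "G = (\<lambda>t. c * t + d - (F t)\<^sup>2 / 2)"
  define H where "H = (\<lambda>t. c - F t * G t)"
  have dF: "(F has_real_derivative G t) (at t)" if "t \<ge> 0" for t
    unfolding F_def G_def
    using u_pos[OF that]
    by (auto intro!: derivative_eq_intros du dv simp: field_simps power2_eq_square)
  have dG: "(G has_real_derivative H t) (at t)" if "t \<ge> 0" for t
  proof -
    have "((\<lambda>t. c * t + d - (F t)\<^sup>2 / 2) has_real_derivative H t) (at t)"
      by (auto intro!: derivative_eq_intros dF[OF that] simp: H_def)
    then show ?thesis by (simp add: G_def[abs_def])
  qed
  have dH: "(H has_real_derivative (- (F t * H t) - (G t)\<^sup>2)) (at t)" if "t \<ge> 0" for t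
  proof -
    have "((\<lambda>t. c - F t * G t) has_real_derivative (- (F t * H t) - (G t)\<^sup>2)) (at t)"
      by (auto intro!: derivative_eq_intros dF[OF that] dG[OF that] simp: power2_eq_square)
    then show ?thesis by (simp add: H_def[abs_def])
  qed
  have F0: "F 0 = b" and G0: "G 0 = a" and H0: "H 0 = -1"
    by (simp_all add: F_def G_def H_def uv0 d_def c_def)

  \<comment> \<open>Since 2 v = F u, the terms with F G cancel. Hence u^2 G is nondecreasing from
    its initial value a > 0, so \<open>G\<close> is positive and \<open>F\<close> increases.\<close>
  have dN: "((\<lambda>t. (u t)\<^sup>2 * G t) has_real_derivative c * (u t)\<^sup>2) (at t)" if "t \<ge> 0" for t
    using u_pos[OF that]
    by (auto intro!: derivative_eq_intros du dG[OF that] simp: H_def F_def field_simps power2_eq_square)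
  have N_ge: "(u t)\<^sup>2 * G t \<ge> a" if "t \<ge> 0" for t
  proof -
    have "(u 0)\<^sup>2 * G 0 \<le> (u t)\<^sup>2 * G t"
      by (rule DERIV_nonneg_imp_nondecreasing[OF that]) (use dN pos in force)
    then show ?thesis by (simp add: uv0 G0)
  qed
  have G_pos: "G t > 0" if "t \<ge> 0" for t
    using N_ge[OF that] \<open>a > 0\<close> by (smt (verit) mult_nonneg_nonpos zero_le_power2)
  have F_unbounded: "LIM t at_top. F t :> at_top" if "c > 0"
  proof -
    have F_mono: "F s \<le> F t" if "0 \<le> s" "s \<le> t" for s t
      by (rule DERIV_nonneg_imp_nondecreasing[OF that(2)])
        (use dF G_pos that(1) in \<open>meson less_imp_le order_trans\<close>)
    have F_pos: "F t > 0" if "t \<ge> 0" for t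
      using u_pos[OF that] v_pos[OF that] by (simp add: F_def)
    have "eventually (\<lambda>t. F t \<ge> Z) at_top" for Z
    proof -
      \<comment> \<open>From \<open>T\<close> on, F' >= 1 as long as 0 <= F <= Z. If
        \<open>F\<close> stayed below Z up to T + |Z|, it would gain at least |Z| from a positive
        value, which is a contradiction.\<close>
      define T where "T = max 0 ((Z\<^sup>2 / 2 - d + 1) / c)"
      have T: "T \<ge> 0" "c * T \<ge> Z\<^sup>2 / 2 - d + 1"
        using \<open>c > 0\<close> by (auto simp: T_def max_def field_simps)
      have "F (T + \<bar>Z\<bar>) \<ge> Z"
      proof (rule ccontr)
        assume less: "\<not> F (T + \<bar>Z\<bar>) \<ge> Z"
        have G_ge: "G s \<ge> 1" if "T \<le> s" "s \<le> T + \<bar>Z\<bar>" for s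
        proof -
          have "F s \<le> Z" "F s \<ge> 0"
            using F_mono[of s "T + \<bar>Z\<bar>"] F_pos[of s] less that T(1) by auto
          then have "(F s)\<^sup>2 \<le> Z\<^sup>2" by (rule power_mono)
          moreover have "c * T \<le> c * s"
            using that \<open>c > 0\<close> by simp
          ultimately show ?thesis using T(2) by (simp add: G_def)
        qed
        have "F T - T \<le> F (T + \<bar>Z\<bar>) - (T + \<bar>Z\<bar>)"
        proof (rule DERIV_nonneg_imp_nondecreasing[of _ _ "\<lambda>s. F s - s"])
          fix s assume s: "T \<le> s" "s \<le> T + \<bar>Z\<bar>"
          have "((\<lambda>s. F s - s) has_real_derivative G s - 1) (at s)"
            using s T(1) by (intro DERIV_diff dF DERIV_ident) auto
          with G_ge[OF s] show "\<exists>y. ((\<lambda>s. F s - s) has_real_derivative y) (at s) \<and> 0 \<le> y"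
            by (intro exI[of _ "G s - 1"]) simp
        qed simp
        with less F_pos[OF T(1)] show False by linarith
      qed
      then show ?thesis
        unfolding eventually_at_top_linorder using F_mono[of "T + \<bar>Z\<bar>"] T(1)
        by (metis abs_ge_zero add_nonneg_nonneg order_trans)
    qed
    then show ?thesis by (simp add: filterlim_at_top)
  qed
  \<comment> \<open>This is the quotient of derivatives needed for l'Hopital's rule. For c = 0 the
    function \<open>F\<close> stays bounded, but the quotient vanishes identically.\<close>
  have c_F: "((\<lambda>t. c / F t) \<longlongrightarrow> 0) at_top"
  proof (cases "c = 0")
    case False
    then have "LIM t at_top. F t :> at_infinity"
      using F_unbounded pos by (intro filterlim_at_top_imp_at_infinity) auto
    then show ?thesis by (intro tendsto_divide_0[OF tendsto_const])
  qed simp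
  have "LIM t at_top. 1 + b / 2 * t :> at_top"
    using b by real_asymp
  then have "LIM t at_top. u t :> at_top"
    by (rule filterlim_at_top_mono) (use u_ge in \<open>auto simp: eventually_at_top_linorder\<close>)
  then have u2: "LIM t at_top. (u t)\<^sup>2 :> at_top"
    by (intro filterlim_pow_at_top) auto
  have du2: "((\<lambda>t. (u t)\<^sup>2) has_real_derivative 2 * u t * v t) (at t)" for t
    by (auto intro!: derivative_eq_intros du)
  have "((\<lambda>t. ((u t)\<^sup>2 * G t) / (u t)\<^sup>2) \<longlongrightarrow> 0) at_top"
  proof (rule lhospital_at_top_at_top[OF u2])
    have "2 * u t * v t \<noteq> 0" if "t \<ge> 0" for t
      using u_pos[OF that] v_pos[OF that] by simp
    then show "eventually (\<lambda>t. 2 * u t * v t \<noteq> 0) at_top"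
      by (rule eventually_mono[OF eventually_ge_at_top])
    show "eventually (\<lambda>t. ((\<lambda>t. (u t)\<^sup>2 * G t) has_real_derivative c * (u t)\<^sup>2) (at t)) at_top"
      using dN by (rule eventually_mono[OF eventually_ge_at_top])
    show "eventually (\<lambda>t. ((\<lambda>t. (u t)\<^sup>2) has_real_derivative 2 * u t * v t) (at t)) at_top"
      using du2 by (rule always_eventually[OF allI])
    have "c / F t = c * (u t)\<^sup>2 / (2 * u t * v t)" if "t \<ge> 0" for t
      using u_pos[OF that] by (simp add: F_def power2_eq_square)
    then have "eventually (\<lambda>t. c / F t = c * (u t)\<^sup>2 / (2 * u t * v t)) at_top"
      by (rule eventually_mono[OF eventually_ge_at_top])
    with c_F show "((\<lambda>t. c * (u t)\<^sup>2 / (2 * u t * v t)) \<longlongrightarrow> 0) at_top"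
      by (rule Lim_transform_eventually)
  qed
  moreover have "eventually (\<lambda>t. ((u t)\<^sup>2 * G t) / (u t)\<^sup>2 = G t) at_top"
  proof (rule eventually_mono[OF eventually_ge_at_top])
    show "((u t)\<^sup>2 * G t) / (u t)\<^sup>2 = G t" if "t \<ge> 0" for t
      using u_pos[OF that] by simp
  qed
  ultimately have G_lim: "(G \<longlongrightarrow> 0) at_top"
    by (rule Lim_transform_eventually)

  \<comment> \<open>Restriction makes the solution extensional. The one-sided derivatives see only
    the half-line, so those of \<open>f\<close> are still given by \<open>G\<close> and
    \<open>H\<close> there.\<close>
  define f where "f = restrict F {0..}"
  have f_ext: "f \<in> extensional {0..}" and f_eq: "\<And>t. t \<ge> 0 \<Longrightarrow> f t = F t"
    by (simp_all add: f_def)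
  have f: "(f has_real_derivative G t) (at t within {0..})" if "t \<ge> 0" for t
    by (rule has_real_derivative_cong_half_line[OF DERIV_subset[OF dF[OF that]]])
      (use that f_eq in auto)
  note f' = differentiable_on_half_derivI[of f, OF f]
  have g: "(half_deriv f has_real_derivative H t) (at t within {0..})" if "t \<ge> 0" for t
    by (rule has_real_derivative_cong_half_line[OF DERIV_subset[OF dG[OF that]]])
      (use that f' in auto)
  note g' = differentiable_on_half_derivI[of "half_deriv f", OF g]
  have h: "(half_deriv (half_deriv f) has_real_derivative (- (F t * H t) - (G t)\<^sup>2))
      (at t within {0..})" if "t \<ge> 0" for t
    by (rule has_real_derivative_cong_half_line[OF DERIV_subset[OF dH[OF that]]])
      (use that g' in auto)
  note h' = differentiable_on_half_derivI[of "half_deriv (half_deriv f)", OF h]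
  have "eventually (\<lambda>t. G t = half_deriv f t) at_top"
    by (rule eventually_mono[OF eventually_ge_at_top[of 0]]) (simp add: f')
  with G_lim have "(half_deriv f \<longlongrightarrow> 0) at_top"
    by (rule Lim_transform_eventually)
  then have "bvp_solution (- b) f"
    using f' g' h' f_ext f_eq by (simp add: bvp_solution_def F0 H0)
  moreover have "half_deriv f 0 = a"
    using f' G0 by simp
  ultimately show ?thesis by blast
qed

section \<open>Classification of the solutions by initial slope\<close>

theorem theorem3p3:
  fixes \<gamma> :: real
  assumes "\<gamma> < 0"
  shows "(\<exists>!f. bvp_solution \<gamma> f \<and> bounded (f ` {0..}))
    \<and> (\<forall>f. bvp_solution \<gamma> f \<and> bounded (f ` {0..}) \<longrightarrow> half_deriv f 0 = - 1 / \<gamma>)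
    \<and> infinite {f. bvp_solution \<gamma> f \<and> \<not> bounded (f ` {0..})}
    \<and> (\<forall>f. bvp_solution \<gamma> f \<and> \<not> bounded (f ` {0..}) \<longrightarrow> half_deriv f 0 > - 1 / \<gamma>)"
proof (intro conjI)
  \<comment> \<open>Here c = -\<gamma> (f'(0) + 1/\<gamma>) with -\<gamma> > 0, so the sign of c
    compares the slope with -1/\<gamma>.\<close>
  have bounded_iff: "bounded (f ` {0..}) \<longleftrightarrow> half_deriv f 0 = - 1 / \<gamma>"
    if "bvp_solution \<gamma> f" for f
    using bvp_solution_bounded_iff[OF that] assms by (simp add: field_simps) linarith
  have ge: "half_deriv f 0 \<ge> - 1 / \<gamma>" if "bvp_solution \<gamma> f" for f
    using bvp_first_integral_nonneg[OF that] assms by (simp add: field_simps)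
  have ex: "\<exists>f. bvp_solution \<gamma> f \<and> half_deriv f 0 = a" if "a \<ge> - 1 / \<gamma>" for a
    using bvp_solution_exists[of "- \<gamma>" a] that assms by (simp add: field_simps)
  show "\<exists>!f. bvp_solution \<gamma> f \<and> bounded (f ` {0..})"
  proof (rule ex_ex1I)
    show "\<exists>f. bvp_solution \<gamma> f \<and> bounded (f ` {0..})"
      using ex[OF order_refl] bounded_iff by blast
    show "f = g" if "bvp_solution \<gamma> f \<and> bounded (f ` {0..})" "bvp_solution \<gamma> g \<and> bounded (g ` {0..})"
      for f g
      using bounded_bvp_solution_unique[of \<gamma> f g] that assms by simp
  qed
  show "\<forall>f. bvp_solution \<gamma> f \<and> bounded (f ` {0..}) \<longrightarrow> half_deriv f 0 = - 1 / \<gamma>"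
    using bounded_iff by blast
  show "\<forall>f. bvp_solution \<gamma> f \<and> \<not> bounded (f ` {0..}) \<longrightarrow> half_deriv f 0 > - 1 / \<gamma>"
    using bounded_iff ge by (simp add: order_less_le) metis
  \<comment> \<open>The initial slopes of unbounded solutions fill an infinite ray, and a finite set
    has only finite images.\<close>
  have "{- 1 / \<gamma><..} \<subseteq> (\<lambda>f. half_deriv f 0) ` {f. bvp_solution \<gamma> f \<and> \<not> bounded (f ` {0..})}"
  proof
    fix a assume "a \<in> {- 1 / \<gamma><..}"
    then have a: "a > - 1 / \<gamma>" by simp
    obtain f where f: "bvp_solution \<gamma> f" "half_deriv f 0 = a"
      using ex[OF less_imp_le[OF a]] by blast
    then have "\<not> bounded (f ` {0..})"
      using bounded_iff[OF f(1)] a by simp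
    with f show "a \<in> (\<lambda>f. half_deriv f 0) ` {f. bvp_solution \<gamma> f \<and> \<not> bounded (f ` {0..})}"
      by blast
  qed
  then show "infinite {f. bvp_solution \<gamma> f \<and> \<not> bounded (f ` {0..})}"
    using infinite_Ioi[of "- 1 / \<gamma>"] finite_subset finite_imageI by metis
qed

end
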